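(* Let $k\in\mathcal{C}$ be a circle in the plane, let $c\in\mathcal{P}$ be its center, and let $\mathcal{K}=\{c\}$ (the one-letter word $c$). Then every straightedge classical (not necessarily terminating) $\mathrm{EC}(\mathcal{D})$ $T=(r,V,E)$ with root $r=k$ (the one-letter word $k$) has a branch $B$ such that for every vertex $u\in B$ the point $c$ is not a letter of $u$. Thus no straightedge classical $\mathrm{EC}(\mathcal{D})$ constructs $\mathcal{K}$ (the center $c$ of $k$) from $r$ (the given circle $k$).
   Context: For a set (alphabet) $A$, $A^*$ is the set of finite words over $A$, including the empty word $\emptyset$. A rooted tree $T=(r,V,E)$ consists of a vertex set $V$, a root $r\in V$ and edges $E\subset V\times V$ such that for every $u\in V$ there is a unique walk from $r$ to $u$; if $(u,v)\in E$ then $v$ is a child of $u$; a leaf is a vertex with no child; a branch is a maximal (finite or infinite) walk; it starts at $r$ and either ends in a leaf or is infinite. $\mathcal{P}=\mathbb{R}^2$ is the set of points, $\mathcal{L}$ the set of lines in $\mathbb{R}^2$, $\mathcal{C}$ the set of circles of positive radius in $\mathbb{R}^2$; elements of $\mathcal{L}\cup\mathcal{C}$ are called curves. For points $a\ne b$, $l(a,b)$ is the line through $a,b$. For points $a$ and $b\neq c$, $k(a,b,c)$ is the circle with center $a$ and radius $|bc|$; moreover $k(a,b,b)=a\in\mathcal{P}$. $\mathcal{D}$ is the set of all open discs in $\mathbb{R}^2$ with positive radii. Let $\mathcal{S}$ be a set of nonempty subsets of $\mathbb{R}^2$ with $(\mathcal{P}\cup\mathcal{L}\cup\mathcal{C})\cap\mathcal{S}=\emptyset$.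 An $\mathrm{EC}(\mathcal{S})$ (Euclidean construction with $\mathcal{S}$-arbitrary points) is a rooted tree $T=(r,V,E)$ with $V\subset(\mathcal{P}\cup\mathcal{L}\cup\mathcal{C}\cup\mathcal{S})^*$ and $r\in(\mathcal{P}\cup\mathcal{L}\cup\mathcal{C})^*$, in which the children of each vertex $u=a_1a_2\dots a_m$, $m\ge0$, are determined by exactly one of the following rules; in rules 1–5, $u$ is deterministic, i.e. $m=0$ or $a_m\notin\mathcal{S}$. 1. $u$ is a leaf. 2. $u$ has exactly one child $a_1\dots a_ma_{m+1}$, where $a_{m+1}=l(a_i,a_j)$ for some $1\le i<j\le m$ with $a_i,a_j\in\mathcal{P}$, $a_i\ne a_j$. 3. $u$ has exactly one child $a_1\dots a_ma_{m+1}$, where $a_{m+1}=k(a_i,a_j,a_k)$ for some $1\le i,j,k\le m$ with $a_i,a_j,a_k\in\mathcal{P}$. 4. $u$ has exactly one child $a_1\dots a_ma_{m+1}$, where $a_{m+1}\in\mathcal{P}$ is an intersection point of two curves $a_i\ne a_j$, $1\le i<j\le m$. 5. $u$ has exactly one child $a_1\dots a_ma_{m+1}$, where $a_{m+1}\in\mathcal{S}$. 6. $m\ge1$, $a_m\in\mathcal{S}$ ($u$ is non-deterministic) and the children of $u$ are exactly the words $a_1\dots a_ma_{m+1}$, one for each point $a_{m+1}\in a_m$. $T$ is a straightedge construction if no edge is obtained by rule 3 with $a_j\ne a_k$. $T$ is classical if $\mathcal{S}=\mathcal{D}$. $T$ is terminating if all its branches are finite. For $\mathcal{K}\subset(\mathcal{P}\cup\mathcal{L}\cup\mathcal{C})^*$,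 an $\mathrm{EC}(\mathcal{S})$ of a certain type constructs $\mathcal{K}$ from $r$ if there is a terminating $\mathrm{EC}(\mathcal{S})$ $T=(r,V,E)$ of that type with root $r$ such that every leaf $a_1\dots a_m$ of $T$ has a final segment $a_ja_{j+1}\dots a_m\in\mathcal{K}$. *)

theory Defs
  imports "HOL-Analysis.Analysis"
begin

subsection \<open>Rooted trees, walks and branches\<close>

record 'v tree =
  tree_root :: 'v
  tree_verts :: "'v set"
  tree_edges :: "('v \<times> 'v) set"

datatype 'v walk = Fin_Walk "'v list" | Inf_Walk "nat \<Rightarrow> 'v"

fun is_walk :: "'v tree \<Rightarrow> 'v walk \<Rightarrow> bool" where
  "is_walk T (Fin_Walk us) \<longleftrightarrow>
     us \<noteq> [] \<and> set us \<subseteq> tree_verts T \<and> successively (\<lambda>u v. (u, v) \<in> tree_edges T) us"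
| "is_walk T (Inf_Walk f) \<longleftrightarrow>
     (\<forall>n. f n \<in> tree_verts T \<and> (f n, f (Suc n)) \<in> tree_edges T)"

fun walk_verts :: "'v walk \<Rightarrow> 'v set" where
  "walk_verts (Fin_Walk us) = set us"
| "walk_verts (Inf_Walk f) = range f"

definition rooted_tree :: "'v tree \<Rightarrow> bool" where
  "rooted_tree T \<longleftrightarrow>
     tree_root T \<in> tree_verts T \<and>
     tree_edges T \<subseteq> tree_verts T \<times> tree_verts T \<and>
     (\<forall>u \<in> tree_verts T.
        \<exists>!us. is_walk T (Fin_Walk us) \<and> hd us = tree_root T \<and> last us = u)"

definition children :: "'v tree \<Rightarrow> 'v \<Rightarrow> 'v set" where
  "children T u = {v. (u, v) \<in> tree_edges T}"

definition leaf :: "'v tree \<Rightarrow> 'v \<Rightarrow> bool" where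
  "leaf T u \<longleftrightarrow> u \<in> tree_verts T \<and> children T u = {}"

text \<open>
  A walk is a part of another one if it is a segment of consecutive vertices of it; the longer
  walk may add vertices at the front as well as at the end.
\<close>
fun subwalk :: "'v walk \<Rightarrow> 'v walk \<Rightarrow> bool" where
  "subwalk (Fin_Walk us) (Fin_Walk vs) \<longleftrightarrow> (\<exists>ps qs. vs = ps @ us @ qs)"
| "subwalk (Fin_Walk us) (Inf_Walk g) \<longleftrightarrow> (\<exists>i. us = map g [i..<i + length us])"
| "subwalk (Inf_Walk f) (Fin_Walk vs) \<longleftrightarrow> False"
| "subwalk (Inf_Walk f) (Inf_Walk g) \<longleftrightarrow> (\<exists>i. \<forall>n. f n = g (i + n))"

definition branch :: "'v tree \<Rightarrow> 'v walk \<Rightarrow> bool" where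
  "branch T B \<longleftrightarrow> is_walk T B \<and> (\<forall>B'. is_walk T B' \<and> subwalk B B' \<longrightarrow> B' = B)"

definition terminating :: "'v tree \<Rightarrow> bool" where
  "terminating T \<longleftrightarrow> (\<forall>B. branch T B \<longrightarrow> (\<exists>us. B = Fin_Walk us))"

subsection \<open>Letters\<close>

type_synonym point = "real ^ 2"

text \<open>
  Lines, circles and the members of \<open>\<S>\<close> are all sets of points, so they share the constructor
  \<open>Fig\<close>. A point is a letter different from its singleton set.
\<close>
datatype letter = Pt point | Fig "point set"

definition line :: "point \<Rightarrow> point \<Rightarrow> point set" where
  "line a b = affine hull {a, b}"

definition lines :: "point set set" where
  "lines = {line a b | a b. a \<noteq> b}"

definition circles :: "point set set" where
  "circles = {sphere a \<rho> | a \<rho>. \<rho> > 0}"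

definition curves :: "point set set" where
  "curves = lines \<union> circles"

definition discs :: "point set set" where
  "discs = {ball a \<rho> | a \<rho>. \<rho> > 0}"

definition compass :: "point \<Rightarrow> point \<Rightarrow> point \<Rightarrow> letter" where
  "compass a b c = (if b = c then Pt a else Fig (sphere a (dist b c)))"

definition basic_letters :: "letter set" where
  "basic_letters = range Pt \<union> Fig ` curves"

definition admissible :: "point set set \<Rightarrow> bool" where
  "admissible \<S> \<longleftrightarrow> {} \<notin> \<S> \<and> basic_letters \<inter> Fig ` \<S> = {}"

subsection \<open>Euclidean constructions with arbitrary points\<close>

text \<open>
  The following relations between a word \<open>u = a\<^sub>1\<dots>a\<^sub>m\<close> and a letter \<open>x = a\<^bsub>m+1\<^esub>\<close> describe which
  letters a single step may append. Positions are counted from 0.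
\<close>

definition line_step :: "letter list \<Rightarrow> letter \<Rightarrow> bool" where
  "line_step u x \<longleftrightarrow>
     (\<exists>i j a b. i < j \<and> j < length u \<and> u ! i = Pt a \<and> u ! j = Pt b \<and> a \<noteq> b \<and>
        x = Fig (line a b))"

text \<open>Here \<open>b\<close> and \<open>c\<close> are the points between which the radius is taken.\<close>
definition compass_step :: "point \<Rightarrow> point \<Rightarrow> letter list \<Rightarrow> letter \<Rightarrow> bool" where
  "compass_step b c u x \<longleftrightarrow>
     (\<exists>i j k a. i < length u \<and> j < length u \<and> k < length u \<and>
        u ! i = Pt a \<and> u ! j = Pt b \<and> u ! k = Pt c \<and> x = compass a b c)"

definition intersection_step :: "letter list \<Rightarrow> letter \<Rightarrow> bool" where
  "intersection_step u x \<longleftrightarrow>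
     (\<exists>i j A B p. i < j \<and> j < length u \<and> u ! i = Fig A \<and> u ! j = Fig B \<and>
        A \<in> curves \<and> B \<in> curves \<and> A \<noteq> B \<and> p \<in> A \<inter> B \<and> x = Pt p)"

definition deterministic :: "point set set \<Rightarrow> letter list \<Rightarrow> bool" where
  "deterministic \<S> u \<longleftrightarrow> u = [] \<or> last u \<notin> Fig ` \<S>"

text \<open>
  One rule is used at each vertex. The only overlap between the rules is that a point already
  constructed may be copied by \<open>compass a b b\<close> and may also be an intersection point; this yields
  the same single child, so the rules can be joined by disjunction.
\<close>
definition EC_rule :: "point set set \<Rightarrow> letter list tree \<Rightarrow> letter list \<Rightarrow> bool" where
  "EC_rule \<S> T u \<longleftrightarrow>
     deterministic \<S> u \<and>
       (leaf T u \<or>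
        (\<exists>x. children T u = {u @ [x]} \<and>
           (line_step u x \<or> (\<exists>b c. compass_step b c u x) \<or> intersection_step u x \<or>
            x \<in> Fig ` \<S>))) \<or>
     (\<exists>S \<in> \<S>. u \<noteq> [] \<and> last u = Fig S \<and> children T u = {u @ [Pt p] | p. p \<in> S})"

definition EC :: "point set set \<Rightarrow> letter list tree \<Rightarrow> bool" where
  "EC \<S> T \<longleftrightarrow>
     admissible \<S> \<and> rooted_tree T \<and>
     tree_verts T \<subseteq> lists (basic_letters \<union> Fig ` \<S>) \<and>
     tree_root T \<in> lists basic_letters \<and>
     (\<forall>u \<in> tree_verts T. EC_rule \<S> T u)"

text \<open>
  For \<open>b \<noteq> c\<close> the letter \<open>compass a b c\<close> is a circle, which no rule other than the compass
  rule can append. So the edges below are those obtained from a proper use of the compass.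
\<close>
definition straightedge :: "letter list tree \<Rightarrow> bool" where
  "straightedge T \<longleftrightarrow>
     \<not> (\<exists>u x b c. (u, u @ [x]) \<in> tree_edges T \<and> b \<noteq> c \<and> compass_step b c u x)"

abbreviation classical_EC :: "letter list tree \<Rightarrow> bool" where
  "classical_EC T \<equiv> EC discs T"

text \<open>
  The type of construction is the parameter \<open>Q\<close>.
\<close>
definition constructs ::
  "point set set \<Rightarrow> (letter list tree \<Rightarrow> bool) \<Rightarrow> letter list set \<Rightarrow> letter list \<Rightarrow> bool" where
  "constructs \<S> Q K r \<longleftrightarrow>
     (\<exists>T. EC \<S> T \<and> Q T \<and> terminating T \<and> tree_root T = r \<and>
        (\<forall>u. leaf T u \<longrightarrow> (\<exists>j < length u. drop j u \<in> K)))"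

subsection \<open>Consistency of the definitions\<close>

lemma rooted_tree_reach:
  assumes "rooted_tree T" "u \<in> tree_verts T"
  obtains ps where "is_walk T (Fin_Walk (ps @ [u]))" "hd (ps @ [u]) = tree_root T"
proof -
  have "\<exists>!us. is_walk T (Fin_Walk us) \<and> hd us = tree_root T \<and> last us = u"
    using assms unfolding rooted_tree_def by blast
  then obtain us where us: "is_walk T (Fin_Walk us)" "hd us = tree_root T" "last us = u"
    by (elim ex1E conjE)
  then have "us = butlast us @ [u]" by auto
  with us that[of "butlast us"] show ?thesis by metis
qed

lemma rooted_tree_walk_to_root:
  assumes T: "rooted_tree T" and w: "is_walk T (Fin_Walk (ps @ [tree_root T]))"
  shows "ps = []"
proof (rule ccontr)
  assume ne: "ps \<noteq> []"
  let ?r = "tree_root T"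
  have "hd ps \<in> tree_verts T"
    using w ne by (cases ps) auto
  then obtain ws where ws: "is_walk T (Fin_Walk ws)" "hd ws = ?r" "last ws = hd ps"
    using T unfolding rooted_tree_def by blast
  let ?vs = "butlast ws @ ps @ [?r]"
  have ws_eq: "ws = butlast ws @ [hd ps]"
    using ws by (metis append_butlast_last_id is_walk.simps(1))
  have "is_walk T (Fin_Walk ?vs)"
    using ws(1) w ne by (subst (asm) ws_eq) (auto simp: successively_append_iff)
  moreover have "hd ?vs = ?r"
    using ws(2) ne by (subst (asm) ws_eq) (auto simp: hd_append split: if_splits)
  moreover have "is_walk T (Fin_Walk [?r])"
    using T by (simp add: rooted_tree_def)
  moreover have "last ?vs = ?r" "hd [?r] = ?r" "last [?r] = ?r" by auto
  moreover have "\<exists>!us. is_walk T (Fin_Walk us) \<and> hd us = ?r \<and> last us = ?r"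
    using T by (simp add: rooted_tree_def)
  ultimately have "?vs = [?r]" by blast
  with ne show False by simp
qed

lemma branch_iff:
  assumes T: "rooted_tree T"
  shows "branch T (Fin_Walk us) \<longleftrightarrow>
           is_walk T (Fin_Walk us) \<and> hd us = tree_root T \<and> leaf T (last us)" (is ?fin)
    and "branch T (Inf_Walk f) \<longleftrightarrow>
           is_walk T (Inf_Walk f) \<and> f 0 = tree_root T" (is ?inf)
proof -
  let ?r = "tree_root T"
  have E: "tree_edges T \<subseteq> tree_verts T \<times> tree_verts T"
    using T by (simp add: rooted_tree_def)
  have seg: "is_walk T (Fin_Walk (map g [i..<Suc (i + n)]))" if "is_walk T (Inf_Walk g)" for g i n
    using that by (induction n) (auto simp: successively_append_iff)
  show ?fin
  proof (intro iffI conjI)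
    assume B: "branch T (Fin_Walk us)"
    then show w: "is_walk T (Fin_Walk us)" by (simp add: branch_def)
    then obtain x xs where us: "us = x # xs" by (cases us) auto
    obtain ps where ps: "is_walk T (Fin_Walk (ps @ [x]))" "hd (ps @ [x]) = ?r"
      using rooted_tree_reach[OF T, of x] w us by auto
    have "is_walk T (Fin_Walk (ps @ us))"
      using ps(1) w us by (auto simp: successively_append_iff)
    moreover have "subwalk (Fin_Walk us) (Fin_Walk (ps @ us))"
      by (metis append_Nil2 subwalk.simps(1))
    ultimately have "ps = []"
      using B unfolding branch_def by blast
    with ps(2) us show "hd us = ?r" by simp
    have "children T (last us) = {}"
    proof (rule ccontr)
      assume "children T (last us) \<noteq> {}"
      then obtain v where v: "(last us, v) \<in> tree_edges T" by (auto simp: children_def)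
      then have "is_walk T (Fin_Walk (us @ [v]))"
        using w E by (auto simp: successively_append_iff)
      moreover have "subwalk (Fin_Walk us) (Fin_Walk (us @ [v]))"
        by (metis append_Nil subwalk.simps(1))
      ultimately show False
        using B unfolding branch_def by blast
    qed
    moreover have "last us \<in> set us" using us by (intro last_in_set) auto
    ultimately show "leaf T (last us)"
      using w by (auto simp: leaf_def)
  next
    assume *: "is_walk T (Fin_Walk us) \<and> hd us = ?r \<and> leaf T (last us)"
    then obtain xs where us: "us = ?r # xs" by (cases us) auto
    have "B = Fin_Walk us" if B: "is_walk T B" "subwalk (Fin_Walk us) B" for B
    proof (cases B)
      case (Fin_Walk vs)
      with B obtain ps qs where vs: "vs = ps @ us @ qs" by auto
      have "is_walk T (Fin_Walk (ps @ [?r]))"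
        using B(1) us by (auto simp: Fin_Walk vs successively_append_iff)
      then have "ps = []" by (rule rooted_tree_walk_to_root[OF T])
      moreover have "qs = []"
      proof (rule ccontr)
        assume "qs \<noteq> []"
        moreover have "us \<noteq> []" using us by simp
        ultimately have "(last us, hd qs) \<in> tree_edges T"
          using B(1) by (auto simp: Fin_Walk vs successively_append_iff)
        with * show False by (auto simp: leaf_def children_def)
      qed
      ultimately show ?thesis by (simp add: Fin_Walk vs)
    next
      case (Inf_Walk g)
      with B obtain i where i: "us = map g [i..<i + length us]" by auto
      have "last us = g (i + length us - 1)"
        using us by (subst i) (simp add: last_map)
      with B(1) Inf_Walk * show ?thesis by (auto simp: leaf_def children_def)
    qed
    with * show "branch T (Fin_Walk us)" by (auto simp: branch_def)
  qed
  show ?inf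
  proof (intro iffI conjI)
    assume B: "branch T (Inf_Walk f)"
    then show w: "is_walk T (Inf_Walk f)" by (simp add: branch_def)
    obtain ps where ps: "is_walk T (Fin_Walk (ps @ [f 0]))" "hd (ps @ [f 0]) = ?r"
      using rooted_tree_reach[OF T, of "f 0"] w by auto
    define g where "g i = (if i < length ps then ps ! i else f (i - length ps))" for i
    have gf: "f n = g (length ps + n)" for n by (simp add: g_def)
    have "g n \<in> tree_verts T \<and> (g n, g (Suc n)) \<in> tree_edges T" for n
    proof (cases "n < length ps")
      case True
      have "((ps @ [f 0]) ! n, (ps @ [f 0]) ! Suc n) \<in> tree_edges T"
        using ps(1) True by (auto simp: successively_conv_nth)
      moreover have "(ps @ [f 0]) ! n = g n"
        using True by (simp add: g_def nth_append)
      moreover have "(ps @ [f 0]) ! Suc n = g (Suc n)"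
        using True by (cases "Suc n = length ps") (simp_all add: g_def nth_append)
      ultimately show ?thesis using E by auto
    next
      case False
      with w show ?thesis by (auto simp: g_def Suc_diff_le)
    qed
    then have "is_walk T (Inf_Walk g)" by simp
    moreover have "subwalk (Inf_Walk f) (Inf_Walk g)" using gf by auto
    ultimately have "Inf_Walk g = Inf_Walk f" using B unfolding branch_def by blast
    then have "g = f" by simp
    moreover have "g 0 = ?r" using ps(2) by (cases ps) (auto simp: g_def)
    ultimately show "f 0 = ?r" by simp
  next
    assume *: "is_walk T (Inf_Walk f) \<and> f 0 = ?r"
    have "B = Inf_Walk f" if B: "is_walk T B" "subwalk (Inf_Walk f) B" for B
    proof (cases B)
      case (Fin_Walk vs)
      with B show ?thesis by simp
    next
      case (Inf_Walk g)
      with B obtain i where i: "\<And>n. f n = g (i + n)" by auto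
      have "g i = ?r" using * i[of 0] by simp
      then have "is_walk T (Fin_Walk (map g [0..<i] @ [?r]))"
        using seg[of g 0 i] B(1) Inf_Walk by simp
      then have "map g [0..<i] = []" by (rule rooted_tree_walk_to_root[OF T])
      then have "i = 0" by simp
      with i Inf_Walk show ?thesis by (auto simp: fun_eq_iff)
    qed
    with * show "branch T (Inf_Walk f)" by (auto simp: branch_def)
  qed
qed

lemma admissible_discs: "admissible discs"
proof -
  have closed: "closed A" if "A \<in> curves" for A
    using that closed_affine_hull[of "{_, _} :: point set"]
    by (auto simp: curves_def lines_def circles_def line_def)
  have "A \<notin> discs" if "A \<in> curves" for A
  proof
    assume "A \<in> discs"
    then obtain a :: point and \<rho> :: real where A: "A = ball a \<rho>" "\<rho> > 0"
      by (auto simp: discs_def)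
    with closed[OF that] have "A = UNIV"
      using clopen[of A] by auto
    with A show False
      using bounded_ball[of a \<rho>] not_bounded_UNIV by metis
  qed
  moreover have "{} \<notin> discs"
    by (simp add: discs_def) (metis ball_eq_empty not_le)
  ultimately show ?thesis
    by (auto simp: admissible_def basic_letters_def)
qed

end

theory Submission
  imports Defs
begin

text \<open>
  There is a dense set of points that is closed under all steps available to the straightedge but
  does not contain \<open>c\<close>; whenever an arbitrary point has to be chosen, we take it from this set.
  The set is the image of the points of the projective plane over the countable field \<open>K\<close> of
  constructible numbers under a real projective map that preserves \<open>k\<close>. This map is the Lorentz
  boost with velocity \<open>s\<close>, and the preimage of \<open>c\<close> is not rational over \<open>K\<close> when \<open>s \<notin> K\<close>.
\<close>

section \<open>Branches along an invariant\<close>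

text \<open>Starting at the root, a child satisfying \<open>P\<close> is chosen again and again. If
  no leaf is ever met, this walk is an infinite branch; otherwise it is cut at the first
  leaf.\<close>

lemma rooted_tree_branch_invariant:
  assumes T: "rooted_tree T" and root: "P (tree_root T)"
    and step: "\<And>u. u \<in> tree_verts T \<Longrightarrow> P u \<Longrightarrow> \<not> leaf T u \<Longrightarrow>
                 \<exists>v. (u, v) \<in> tree_edges T \<and> P v"
  obtains B where "branch T B" "\<And>u. u \<in> walk_verts B \<Longrightarrow> P u"
proof -
  have E: "tree_edges T \<subseteq> tree_verts T \<times> tree_verts T" and r: "tree_root T \<in> tree_verts T"
    using T by (auto simp: rooted_tree_def)
  \<comment> \<open>At a leaf the chosen value is arbitrary, so \<open>inv\<close> speaks of
    \<open>f n\<close> only while no earlier vertex is a leaf.\<close>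
  define N where "N u = (SOME v. (u, v) \<in> tree_edges T \<and> P v)" for u
  define f where "f n = (N ^^ n) (tree_root T)" for n
  have N: "(u, N u) \<in> tree_edges T \<and> P (N u)"
    if "u \<in> tree_verts T" "P u" "\<not> leaf T u" for u
    unfolding N_def by (rule someI_ex) (rule step[OF that])
  have f0: "f 0 = tree_root T" and fSuc: "f (Suc n) = N (f n)" for n
    by (simp_all add: f_def)
  have inv: "f n \<in> tree_verts T \<and> P (f n)" if "\<forall>m<n. \<not> leaf T (f m)" for n
    using that
  proof (induction n)
    case 0
    show ?case using r root by (simp add: f0)
  next
    case (Suc n)
    then have "(f n, N (f n)) \<in> tree_edges T \<and> P (N (f n))" by (intro N) auto
    then show ?case using E by (auto simp: fSuc)
  qed
  show ?thesis
  proof (cases "\<exists>n. leaf T (f n)")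
    case False
    then have *: "f n \<in> tree_verts T" "P (f n)" for n using inv by auto
    then have "(f n, f (Suc n)) \<in> tree_edges T" for n
      using N False by (simp add: fSuc)
    then have "branch T (Inf_Walk f)"
      using * by (simp add: branch_iff(2)[OF T] f0)
    then show ?thesis using * by (intro that) auto
  next
    case True
    define n where "n = (LEAST n. leaf T (f n))"
    have lf: "leaf T (f n)" unfolding n_def using True by (rule LeastI_ex)
    have nl: "\<not> leaf T (f m)" if "m < n" for m
      using that not_less_Least unfolding n_def by blast
    then have *: "f m \<in> tree_verts T" "P (f m)" if "m \<le> n" for m
      using inv[of m] that by auto
    have "(f m, f (Suc m)) \<in> tree_edges T" if "m < n" for m
      using N[of "f m"] *[of m] nl[OF that] that by (simp add: fSuc)
    then have "is_walk T (Fin_Walk (map f [0..<Suc n]))"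
      using * by (auto simp: successively_conv_nth nth_append simp del: upt_Suc)
    moreover have "hd (map f [0..<Suc n]) = tree_root T"
      by (simp add: hd_map f0 del: upt_Suc)
    ultimately have "branch T (Fin_Walk (map f [0..<Suc n]))"
      using lf by (simp add: branch_iff(1)[OF T])
    then show ?thesis using * by (intro that) auto
  qed
qed

section \<open>Constructible numbers\<close>

text \<open>Encoding the closure under field operations and square roots by terms yields
  countability at once. Since \<open>inverse\<close> and \<open>sqrt\<close> are total on the reals,
  every term has a value and no side conditions arise.\<close>

datatype expr = One | Sub expr expr | Mult expr expr | Inv expr | Sqrt expr

instance expr :: countable by countable_datatype

fun expr_val :: "expr \<Rightarrow> real" where
  "expr_val One = 1"
| "expr_val (Sub e f) = expr_val e - expr_val f"
| "expr_val (Mult e f) = expr_val e * expr_val f"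
| "expr_val (Inv e) = inverse (expr_val e)"
| "expr_val (Sqrt e) = sqrt (expr_val e)"

definition constructible :: "real set" where
  "constructible = range expr_val"

lemma countable_constructible: "countable constructible"
  by (simp add: constructible_def)

lemma constructible_1: "1 \<in> constructible"
  unfolding constructible_def by (rule range_eqI[of _ _ One]) simp

lemma constructible_diff:
  assumes "x \<in> constructible" "y \<in> constructible"
  shows "x - y \<in> constructible"
proof -
  obtain e f where "x = expr_val e" "y = expr_val f"
    using assms by (auto simp: constructible_def)
  then show ?thesis
    unfolding constructible_def by (intro range_eqI[of _ _ "Sub e f"]) simp
qed

lemma constructible_mult:
  assumes "x \<in> constructible" "y \<in> constructible"
  shows "x * y \<in> constructible"
proof -
  obtain e f where "x = expr_val e" "y = expr_val f"
    using assms by (auto simp: constructible_def)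
  then show ?thesis
    unfolding constructible_def by (intro range_eqI[of _ _ "Mult e f"]) simp
qed

lemma constructible_inverse:
  assumes "x \<in> constructible"
  shows "inverse x \<in> constructible"
proof -
  obtain e where "x = expr_val e"
    using assms by (auto simp: constructible_def)
  then show ?thesis
    unfolding constructible_def by (intro range_eqI[of _ _ "Inv e"]) simp
qed

lemma constructible_sqrt:
  assumes "x \<in> constructible"
  shows "sqrt x \<in> constructible"
proof -
  obtain e where "x = expr_val e"
    using assms by (auto simp: constructible_def)
  then show ?thesis
    unfolding constructible_def by (intro range_eqI[of _ _ "Sqrt e"]) simp
qed

lemma constructible_0: "0 \<in> constructible"
  using constructible_diff[OF constructible_1 constructible_1] by simp

lemma constructible_minus: "x \<in> constructible \<Longrightarrow> - x \<in> constructible"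
  using constructible_diff[OF constructible_0] by simp

lemma constructible_add: "x \<in> constructible \<Longrightarrow> y \<in> constructible \<Longrightarrow> x + y \<in> constructible"
  using constructible_diff[OF _ constructible_minus] by simp

lemma constructible_divide:
  "x \<in> constructible \<Longrightarrow> y \<in> constructible \<Longrightarrow> x / y \<in> constructible"
  by (simp add: divide_inverse constructible_inverse constructible_mult)

lemmas constructible_intros = constructible_0 constructible_1 constructible_add
  constructible_minus constructible_diff constructible_mult constructible_divide
  constructible_sqrt

lemma Rats_subset_constructible: "\<rat> \<subseteq> constructible"
proof -
  have nat: "real n \<in> constructible" for n
    by (induction n) (auto intro: constructible_intros)
  have "real_of_int i \<in> constructible" for i
    by (cases i rule: int_cases2) (auto intro: constructible_intros nat)
  then show ?thesis
    by (auto elim!: Rats_cases' intro: constructible_intros)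
qed

text \<open>Such vectors serve as homogeneous coordinates over \<open>constructible\<close>, both of
  points and of lines (as normal vectors).\<close>

definition constructible3 :: "(real ^ 3) set" where
  "constructible3 = {v. \<forall>i. v $ i \<in> constructible}"

text \<open>The cross product gives the line joining two points as well as the point common to two
  lines; its entries are polynomials in the given coordinates.\<close>

lemma cross3_constructible3:
  "v \<in> constructible3 \<Longrightarrow> w \<in> constructible3 \<Longrightarrow> cross3 v w \<in> constructible3"
  by (auto simp: constructible3_def cross3_def forall_3 intro!: constructible_intros)

section \<open>A projective map preserving a circle\<close>

text \<open>By Lagrange's identity for the triple vector product,
  \<open>cross3 q (cross3 n m)\<close> is a combination of \<open>n\<close> and \<open>m\<close>
  with coefficients \<open>m \<bullet> q\<close> and \<open>n \<bullet> q\<close> up to sign, so it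
  vanishes.\<close>

lemma orthogonal_both_cross3:
  assumes "n \<bullet> q = 0" "m \<bullet> q = 0" "cross3 n m \<noteq> 0"
  obtains t where "q = t *\<^sub>R cross3 n m"
proof -
  have "cross3 q (cross3 n m) = 0"
    using assms by (simp add: Lagrange inner_commute)
  then have "collinear {0, cross3 n m, q}"
    by (simp add: cross_eq_0 insert_commute)
  then show ?thesis
    using assms(3) that by (auto simp: collinear_lemma)
qed

lemma in_line_iff:
  assumes "a \<noteq> b"
  shows "p \<in> line a b \<longleftrightarrow> (p $ 1 - a $ 1) * (b $ 2 - a $ 2) = (b $ 1 - a $ 1) * (p $ 2 - a $ 2)"
    (is "_ \<longleftrightarrow> ?det")
proof
  show ?det if "p \<in> line a b"
    using that by (auto simp: line_def affine_hull_2_alt)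
  show "p \<in> line a b" if ?det
  proof -
    have "\<exists>t. p $ 1 = a $ 1 + t * (b $ 1 - a $ 1) \<and> p $ 2 = a $ 2 + t * (b $ 2 - a $ 2)"
    proof (cases "b $ 1 = a $ 1")
      case True
      then have "b $ 2 - a $ 2 \<noteq> 0" using assms by (simp add: vec_eq_iff forall_2)
      then show ?thesis using that True
        by (intro exI[of _ "(p $ 2 - a $ 2) / (b $ 2 - a $ 2)"]) simp
    next
      case False
      then show ?thesis using that
        by (intro exI[of _ "(p $ 1 - a $ 1) / (b $ 1 - a $ 1)"]) simp
    qed
    then show ?thesis
      by (auto simp: line_def affine_hull_2_alt vec_eq_iff forall_2)
  qed
qed

text \<open>The equation of the line fixes \<open>a * x + b * y\<close>, and the identity for
  products of sums of two squares then fixes the square of \<open>e = a * y - b * x\<close>. So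
  \<open>e\<close> costs one square root, after which \<open>x\<close> and \<open>y\<close> solve a
  linear system of determinant \<open>a\<^sup>2 + b\<^sup>2\<close>.\<close>

lemma line_circle_intersection:
  fixes x y :: real
  assumes "a * x + b * y + d = 0" "x\<^sup>2 + y\<^sup>2 = 1" "a \<in> constructible" "b \<in> constructible" "d \<in> constructible"
    and ab: "a \<noteq> 0 \<or> b \<noteq> 0"
  shows "x \<in> constructible" "y \<in> constructible"
proof -
  define e where "e = a * y - b * x"
  have e2: "e\<^sup>2 = a\<^sup>2 + b\<^sup>2 - d\<^sup>2"
  proof -
    have d: "d = - (a * x + b * y)" using assms(1) by simp
    have "e\<^sup>2 + d\<^sup>2 = (a\<^sup>2 + b\<^sup>2) * (x\<^sup>2 + y\<^sup>2)"
      unfolding e_def d by (simp add: power2_eq_square algebra_simps)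
    then show ?thesis using assms(2) by simp
  qed
  have "\<bar>e\<bar> = sqrt (a * a + b * b - d * d)"
    using e2 by (simp add: power2_eq_square flip: real_sqrt_abs)
  then have "\<bar>e\<bar> \<in> constructible"
    using assms by (auto intro!: constructible_intros)
  \<comment> \<open>The sign of \<open>e\<close> depends on which of the two intersection points is
    given; either sign stays in the field.\<close>
  then have eK: "e \<in> constructible"
    using constructible_minus[of "- e"] by (auto simp: abs_if split: if_splits)
  have pos: "a * a + b * b \<noteq> 0" using ab by (simp add: sum_squares_eq_zero_iff)
  have "x * (a * a + b * b) = - (a * d) - b * e" "y * (a * a + b * b) = a * e - b * d"
    using assms(1) unfolding e_def by algebra+
  then have "x = (- (a * d) - b * e) / (a * a + b * b)" "y = (a * e - b * d) / (a * a + b * b)"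
    using pos by (simp_all add: eq_divide_eq)
  moreover have "(- (a * d) - b * e) / (a * a + b * b) \<in> constructible" "(a * e - b * d) / (a * a + b * b) \<in> constructible"
    using assms eK by (auto intro!: constructible_intros)
  ultimately show "x \<in> constructible" "y \<in> constructible" by simp_all
qed

section \<open>Points and lines that become rational over \<open>constructible\<close> after a
  Lorentz boost\<close>

locale boosted_circle =
  fixes c :: point and \<rho> s :: real
  assumes \<rho>: "\<rho> > 0" and s: "0 < s" "s < 1" "s \<notin> constructible"
begin

text \<open>In coordinates in which the circle is the unit circle, this is the Lorentz boost of
  \<open>(x, y, 1)\<close>, rescaled by \<open>sqrt (1 - s\<^sup>2)\<close>, which does not change
  the projective point. It multiplies the form \<open>X\<^sup>2 + Y\<^sup>2 - Z\<^sup>2\<close> by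
  \<open>1 - s\<^sup>2\<close>, hence maps the unit circle to itself.\<close>

definition boost :: "point \<Rightarrow> real ^ 3" where
  "boost p = (let x = (p $ 1 - c $ 1) / \<rho>; y = (p $ 2 - c $ 2) / \<rho>
              in vector [x + s, sqrt (1 - s\<^sup>2) * y, 1 + s * x])"

text \<open>Rationality is required only up to a real factor, and the third coordinate may be 0.
  Hence intersections that the boost sends to infinity are included.\<close>

definition good_points :: "point set" where
  "good_points = {p. \<exists>v \<in> constructible3. \<exists>t. boost p = t *\<^sub>R v}"

definition good_lines :: "point set set" where
  "good_lines = {{p. n \<bullet> boost p = 0} | n. n \<in> constructible3 \<and> n \<noteq> 0}"

lemma velocity_bounds: "s\<^sup>2 < 1" "0 < sqrt (1 - s\<^sup>2)" "(sqrt (1 - s\<^sup>2))\<^sup>2 = 1 - s\<^sup>2"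
proof -
  show "s\<^sup>2 < 1" using s by (simp add: power_less_one_iff)
  then show "0 < sqrt (1 - s\<^sup>2)" "(sqrt (1 - s\<^sup>2))\<^sup>2 = 1 - s\<^sup>2" by simp_all
qed

lemma boost_nonzero: "boost p \<noteq> 0"
proof
  assume "boost p = 0"
  then have "(p $ 1 - c $ 1) / \<rho> + s = 0" "1 + s * ((p $ 1 - c $ 1) / \<rho>) = 0"
    by (auto simp: boost_def Let_def vec_eq_iff forall_3)
  then have "1 - s\<^sup>2 = 0" by algebra
  then show False using velocity_bounds by simp
qed

text \<open>The center is sent to \<open>(s, 0, 1)\<close>, and the ratio \<open>s\<close> of two of
  these coordinates would lie in \<open>constructible\<close>.\<close>

lemma center_not_good: "c \<notin> good_points"
proof
  assume "c \<in> good_points"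
  then obtain v t where v: "v \<in> constructible3" "boost c = t *\<^sub>R v"
    by (auto simp: good_points_def)
  then have "s = t * v $ 1" "1 = t * v $ 3"
    by (auto simp: boost_def vec_eq_iff forall_3)
  moreover from this have "v $ 3 \<noteq> 0" "t \<noteq> 0" by auto
  ultimately have "s = v $ 1 / v $ 3" by (simp add: eq_divide_eq)
  then show False
    using s v(1) by (auto simp: constructible3_def intro: constructible_divide)
qed

text \<open>A linear map multiplies triple products by its determinant, here
  \<open>sqrt (1 - s\<^sup>2) * (1 - s\<^sup>2)\<close>, which is nonzero. So collinearity can be
  tested after the boost.\<close>

lemma line_iff_boost:
  assumes "a \<noteq> b"
  shows "p \<in> line a b \<longleftrightarrow> cross3 (boost a) (boost b) \<bullet> boost p = 0"
proof -
  have "p \<in> line a b \<longleftrightarrow> (p $ 1 - a $ 1) * (b $ 2 - a $ 2) = (b $ 1 - a $ 1) * (p $ 2 - a $ 2)"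
    using assms by (rule in_line_iff)
  also have "\<dots> \<longleftrightarrow> cross3 (boost a) (boost b) \<bullet> boost p = 0"
  proof -
    define x where "x p = (p $ 1 - c $ 1) / \<rho>" for p :: point
    define y where "y p = (p $ 2 - c $ 2) / \<rho>" for p :: point
    \<comment> \<open>\<open>D\<close> is the triple product of the vectors \<open>(x, y, 1)\<close>
      belonging to \<open>a\<close>, \<open>b\<close> and \<open>p\<close>.\<close>
    define D where "D = (x b - x a) * (y p - y a) - (x p - x a) * (y b - y a)"
    have diff: "q $ 1 - q' $ 1 = \<rho> * (x q - x q')" "q $ 2 - q' $ 2 = \<rho> * (y q - y q')" for q q'
      using \<rho> by (simp_all add: x_def y_def flip: diff_divide_distrib)
    have "(b $ 1 - a $ 1) * (p $ 2 - a $ 2) - (p $ 1 - a $ 1) * (b $ 2 - a $ 2) = \<rho>\<^sup>2 * D"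
      unfolding diff D_def by (simp add: power2_eq_square algebra_simps)
    moreover have "\<rho>\<^sup>2 * D = 0 \<longleftrightarrow> sqrt (1 - s\<^sup>2) * (1 - s\<^sup>2) * D = 0"
      using \<rho> velocity_bounds by simp
    moreover have "sqrt (1 - s\<^sup>2) * (1 - s\<^sup>2) * D = cross3 (boost a) (boost b) \<bullet> boost p"
      unfolding D_def boost_def x_def[symmetric] y_def[symmetric]
      by (simp add: Let_def cross3_def inner_vec_def sum_3) algebra
    ultimately show ?thesis by linarith
  qed
  finally show ?thesis .
qed

lemma line_good:
  assumes "a \<in> good_points" "b \<in> good_points" "a \<noteq> b"
  shows "line a b \<in> good_lines"
proof -
  obtain v t where v: "v \<in> constructible3" "boost a = t *\<^sub>R v"
    using assms(1) unfolding good_points_def by blast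
  obtain w r where w: "w \<in> constructible3" "boost b = r *\<^sub>R w"
    using assms(2) unfolding good_points_def by blast
  have tr: "t \<noteq> 0" "r \<noteq> 0"
    using boost_nonzero[of a] boost_nonzero[of b] unfolding v(2) w(2) by auto
  have eq: "line a b = {p. cross3 v w \<bullet> boost p = 0}"
    unfolding set_eq_iff mem_Collect_eq line_iff_boost[OF assms(3)] v(2) w(2)
    by (simp add: tr cross_mult_left cross_mult_right)
  have "cross3 v w \<noteq> 0"
  proof
    assume "cross3 v w = 0"
    then have "line a b = UNIV" unfolding eq by simp
    then have "aff_dim {a, b} = aff_dim (UNIV :: point set)"
      unfolding line_def by (metis aff_dim_affine_hull)
    then show False using assms(3) by (simp add: aff_dim_2)
  qed
  then show ?thesis
    unfolding good_lines_def using eq cross3_constructible3[OF v(1) w(1)] by auto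
qed

text \<open>The vector of a common point is orthogonal to both normals, hence a multiple of their
  cross product. Were this product zero, the normals would be proportional and the lines
  equal.\<close>

lemma lines_inter_good:
  assumes "A \<in> good_lines" "B \<in> good_lines" "A \<noteq> B" "p \<in> A" "p \<in> B"
  shows "p \<in> good_points"
proof -
  obtain n where n: "n \<in> constructible3" "n \<noteq> 0" "A = {p. n \<bullet> boost p = 0}"
    using assms(1) unfolding good_lines_def by blast
  obtain m where m: "m \<in> constructible3" "m \<noteq> 0" "B = {p. m \<bullet> boost p = 0}"
    using assms(2) unfolding good_lines_def by blast
  have "cross3 n m \<noteq> 0"
  proof
    assume "cross3 n m = 0"
    then obtain t where t: "m = t *\<^sub>R n"
      using n(2) m(2) unfolding cross_eq_0 collinear_lemma by blast
    then have "t \<noteq> 0" using m by auto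
    then have "A = B" unfolding n(3) m(3) t by simp
    with assms(3) show False by simp
  qed
  moreover have "n \<bullet> boost p = 0" "m \<bullet> boost p = 0" using assms n m by auto
  ultimately obtain t where "boost p = t *\<^sub>R cross3 n m"
    using orthogonal_both_cross3 by blast
  then show ?thesis
    unfolding good_points_def using cross3_constructible3[OF n(1) m(1)] by blast
qed

text \<open>The boost keeps the circle on the cone \<open>X\<^sup>2 + Y\<^sup>2 = Z\<^sup>2\<close>.
  Dividing by the third coordinate therefore leaves the intersection of the unit circle with a line
  whose coefficients are constructible.\<close>

lemma line_circle_inter_good:
  assumes "A \<in> good_lines" "p \<in> A" "p \<in> sphere c \<rho>"
  shows "p \<in> good_points"
proof -
  obtain n where n: "n \<in> constructible3" "n \<noteq> 0" "n \<bullet> boost p = 0"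
    using assms by (auto simp: good_lines_def)
  define q where "q = boost p"
  define x where "x = (p $ 1 - c $ 1) / \<rho>"
  define y where "y = (p $ 2 - c $ 2) / \<rho>"
  have "(p $ 1 - c $ 1)\<^sup>2 + (p $ 2 - c $ 2)\<^sup>2 = \<rho>\<^sup>2"
  proof -
    have "(dist c p)\<^sup>2 = (p $ 1 - c $ 1)\<^sup>2 + (p $ 2 - c $ 2)\<^sup>2"
      by (simp add: dist_vec_def L2_set_def sum_2 dist_real_def power2_commute)
    then show ?thesis using assms(3) by simp
  qed
  then have xy: "x\<^sup>2 + y\<^sup>2 = 1"
    using \<rho> by (simp add: x_def y_def power_divide flip: add_divide_distrib)
  have q: "q $ 1 = x + s" "q $ 2 = sqrt (1 - s\<^sup>2) * y" "q $ 3 = 1 + s * x"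
    by (simp_all add: q_def boost_def Let_def x_def y_def)
  have cone: "(q $ 1)\<^sup>2 + (q $ 2)\<^sup>2 = (q $ 3)\<^sup>2"
    unfolding q power_mult_distrib velocity_bounds(3) using xy by algebra
  have q3: "q $ 3 \<noteq> 0"
  proof
    assume "q $ 3 = 0"
    with cone have "q = 0" by (simp add: vec_eq_iff forall_3 sum_power2_eq_zero_iff)
    then show False using boost_nonzero by (simp add: q_def)
  qed
  have nq: "n $ 1 * q $ 1 + n $ 2 * q $ 2 + n $ 3 * q $ 3 = 0"
    using n(3) by (simp add: q_def inner_vec_def sum_3)
  \<comment> \<open>With both entries zero, \<open>nq\<close> would leave
    \<open>n $ 3 * q $ 3 = 0\<close> and thus \<open>n = 0\<close>.\<close>
  have ab: "n $ 1 \<noteq> 0 \<or> n $ 2 \<noteq> 0"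
    using nq q3 n(2) by (auto simp: vec_eq_iff forall_3)
  have "n $ 1 * (q $ 1 / q $ 3) + n $ 2 * (q $ 2 / q $ 3) + n $ 3 = 0"
    using nq q3 by (simp add: field_simps)
  moreover have "(q $ 1 / q $ 3)\<^sup>2 + (q $ 2 / q $ 3)\<^sup>2 = 1"
    using cone q3 by (simp add: power_divide flip: add_divide_distrib)
  moreover have "n $ i \<in> constructible" for i
    using n(1) by (simp add: constructible3_def)
  ultimately have "q $ 1 / q $ 3 \<in> constructible" "q $ 2 / q $ 3 \<in> constructible"
    using line_circle_intersection[OF _ _ _ _ _ ab] by blast+
  then have "vector [q $ 1 / q $ 3, q $ 2 / q $ 3, 1] \<in> constructible3"
    by (simp add: constructible3_def forall_3 constructible_1)
  moreover have "boost p = q $ 3 *\<^sub>R vector [q $ 1 / q $ 3, q $ 2 / q $ 3, 1]"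
    using q3 by (simp add: vec_eq_iff forall_3 q_def[symmetric])
  ultimately show ?thesis by (auto simp: good_points_def)
qed

text \<open>Away from the line sent to infinity, the boost is an invertible continuous map in affine
  coordinates. Rational points near the image of a point of the ball pull back to good points in the
  ball.\<close>

lemma good_points_dense:
  assumes r: "r > 0"
  obtains p where "p \<in> good_points" "p \<in> ball a r"
proof -
  \<comment> \<open>Points with \<open>1 + s * x = 0\<close> correspond to the line at infinity of the other plane.\<close>
  obtain p0 where p0: "p0 \<in> ball a r" "1 + s * ((p0 $ 1 - c $ 1) / \<rho>) \<noteq> 0"
  proof (cases "1 + s * ((a $ 1 - c $ 1) / \<rho>) = 0")
    case False
    then show ?thesis using r by (intro that[of a]) auto
  next
    case True
    \<comment> \<open>A horizontal shift by half the radius leaves the exceptional vertical line and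
      stays inside the ball.\<close>
    let ?p = "a + (r / 2) *\<^sub>R axis 1 1"
    have "1 + s * ((?p $ 1 - c $ 1) / \<rho>) = s * (r / 2 / \<rho>) + (1 + s * ((a $ 1 - c $ 1) / \<rho>))"
      by (simp add: axis_def add_divide_distrib diff_divide_distrib algebra_simps)
    moreover have "s * (r / 2 / \<rho>) \<noteq> 0" using s r \<rho> by simp
    ultimately have "1 + s * ((?p $ 1 - c $ 1) / \<rho>) \<noteq> 0" using True by linarith
    moreover have "?p \<in> ball a r" using r by (simp add: dist_norm norm_axis_1)
    ultimately show ?thesis using that by blast
  qed
  define x y where "x = (p0 $ 1 - c $ 1) / \<rho>" and "y = (p0 $ 2 - c $ 2) / \<rho>"
  define W where "W = 1 + s * x"
  \<comment> \<open>\<open>(u, w)\<close> is the boosted \<open>p0\<close> in affine coordinates;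
    \<open>X\<close> and \<open>Y\<close> below invert the map, \<open>X\<close> being the same
    velocity addition with \<open>-s\<close> for \<open>s\<close>.\<close>
  define u where "u = (x + s) / W"
  define w where "w = sqrt (1 - s\<^sup>2) * y / W"
  have W: "W \<noteq> 0" using p0 by (simp add: W_def x_def)
  have su: "1 - s * u = (1 - s\<^sup>2) / W"
    using W by (simp add: u_def W_def field_simps power2_eq_square)
  then have su0: "1 - s * u \<noteq> 0" using W velocity_bounds by simp
  define X where "X u = (u - s) / (1 - s * u)" for u
  define Y where "Y u w = w * (1 + s * X u) / sqrt (1 - s\<^sup>2)" for u w
  define \<psi> where "\<psi> u w = (vector [c $ 1 + \<rho> * X u, c $ 2 + \<rho> * Y u w] :: point)" for u w
  have Xu: "X u = x"
  proof -
    have "u - s = x * (1 - s * u)"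
      unfolding su using W by (simp add: u_def W_def field_simps power2_eq_square)
    then show ?thesis using su0 by (simp add: X_def)
  qed
  have Yw: "Y u w = y"
    unfolding Y_def Xu using velocity_bounds W by (simp add: w_def W_def)
  have \<psi>0: "\<psi> u w = p0"
    using \<rho> by (simp add: \<psi>_def Xu Yw x_def y_def vec_eq_iff forall_2)
  obtain un where un: "\<And>n. un n \<in> \<rat>" "un \<longlonglongrightarrow> u"
    using Rats_closure_real closure_sequential[of u \<rat>] by auto
  obtain wn where wn: "\<And>n. wn n \<in> \<rat>" "wn \<longlonglongrightarrow> w"
    using Rats_closure_real closure_sequential[of w \<rat>] by auto
  have X: "(\<lambda>n. X (un n)) \<longlonglongrightarrow> X u"
    unfolding X_def by (intro tendsto_intros un su0)
  have Y: "(\<lambda>n. Y (un n) (wn n)) \<longlonglongrightarrow> Y u w"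
    unfolding Y_def using velocity_bounds(2) by (intro tendsto_intros X wn) simp
  have "(\<lambda>n. \<psi> (un n) (wn n)) \<longlonglongrightarrow> p0"
    unfolding \<psi>0[symmetric]
  proof (rule vec_tendstoI)
    fix i :: 2
    show "(\<lambda>n. \<psi> (un n) (wn n) $ i) \<longlonglongrightarrow> \<psi> u w $ i"
      using exhaust_2[of i] tendsto_add[OF tendsto_const tendsto_mult_left[OF X]]
        tendsto_add[OF tendsto_const tendsto_mult_left[OF Y]]
      by (auto simp: \<psi>_def)
  qed
  then have "\<forall>\<^sub>F n in sequentially. \<psi> (un n) (wn n) \<in> ball a r"
    using topological_tendstoD p0(1) open_ball by blast
  \<comment> \<open>Division by zero would give \<open>X (un n)\<close> the value 0 and break the
    identity \<open>*\<close> below, so late indices with a nonzero denominator are taken.\<close>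
  moreover have "\<forall>\<^sub>F n in sequentially. 1 - s * un n \<noteq> 0"
    by (rule tendsto_imp_eventually_ne[OF _ su0]) (intro tendsto_intros un)
  ultimately have "\<forall>\<^sub>F n in sequentially. \<psi> (un n) (wn n) \<in> ball a r \<and> 1 - s * un n \<noteq> 0"
    by (rule eventually_conj)
  then obtain n where n: "\<psi> (un n) (wn n) \<in> ball a r" "1 - s * un n \<noteq> 0"
    using eventually_happens trivial_limit_sequentially by blast
  have *: "X (un n) + s = (1 + s * X (un n)) * un n"
    using n(2) by (simp add: X_def divide_simps) algebra
  have "boost (\<psi> (un n) (wn n)) = (1 + s * X (un n)) *\<^sub>R vector [un n, wn n, 1]"
    using \<rho> velocity_bounds * by (simp add: boost_def Let_def \<psi>_def vec_eq_iff forall_3 Y_def)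
  moreover have "vector [un n, wn n, 1] \<in> constructible3"
    using un wn Rats_subset_constructible
    by (auto simp: constructible3_def forall_3 constructible_1)
  ultimately have "\<psi> (un n) (wn n) \<in> good_points" by (auto simp: good_points_def)
  with n that show ?thesis by blast
qed

section \<open>The invariant\<close>

text \<open>Every disc is allowed, because it only matters which of its points gets chosen. The
  given circle is the only circle, since the straightedge produces no other.\<close>

fun good_letter :: "letter \<Rightarrow> bool" where
  "good_letter (Pt p) \<longleftrightarrow> p \<in> good_points"
| "good_letter (Fig A) \<longleftrightarrow> A \<in> discs \<or> A = sphere c \<rho> \<or> A \<in> good_lines"

lemma line_step_good:
  assumes "line_step u x" "\<forall>y \<in> set u. good_letter y"
  shows "good_letter x"
proof -
  obtain i j a b where *: "i < j" "j < length u" "u ! i = Pt a" "u ! j = Pt b" "a \<noteq> b"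
    "x = Fig (line a b)"
    using assms(1) by (auto simp: line_step_def)
  then have "Pt a \<in> set u" "Pt b \<in> set u"
    by (metis nth_mem order.strict_trans)+
  then have "good_letter (Pt a)" "good_letter (Pt b)" using assms(2) by blast+
  then show ?thesis using * line_good by simp
qed

text \<open>Discs are not curves, and two distinct good curves cannot both be the given circle. So
  at least one is a good line, and the other is a good line or that circle.\<close>

lemma intersection_step_good:
  assumes "intersection_step u x" "\<forall>y \<in> set u. good_letter y"
  shows "good_letter x"
proof -
  obtain i j A B p where *: "i < j" "j < length u" "u ! i = Fig A" "u ! j = Fig B"
    "A \<in> curves" "B \<in> curves" "A \<noteq> B" "p \<in> A" "p \<in> B" "x = Pt p"
    using assms(1) unfolding intersection_step_def by blast
  then have "Fig A \<in> set u" "Fig B \<in> set u"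
    by (metis nth_mem order.strict_trans)+
  then have "good_letter (Fig A)" "good_letter (Fig B)"
    using assms(2) by blast+
  moreover have "A \<notin> discs" "B \<notin> discs"
    using admissible_discs * by (auto simp: admissible_def basic_letters_def)
  ultimately show ?thesis
    using * lines_inter_good line_circle_inter_good by auto
qed

text \<open>A straightedge construction may still use the compass with radius zero, which merely
  repeats an existing point.\<close>

lemma copy_good:
  assumes "compass_step b b u x" "\<forall>y \<in> set u. good_letter y"
  shows "good_letter x"
proof -
  obtain i a where "i < length u" "u ! i = Pt a" "x = Pt a"
    using assms(1) by (auto simp: compass_step_def compass_def)
  then show ?thesis using assms(2) nth_mem by metis
qed

lemma good_branch:
  assumes EC: "classical_EC T" and se: "straightedge T" and root: "tree_root T = [Fig (sphere c \<rho>)]"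
  obtains B where "branch T B" "\<And>u. u \<in> walk_verts B \<Longrightarrow> Pt c \<notin> set u"
proof -
  have T: "rooted_tree T" using EC by (simp add: EC_def)
  have "\<exists>v. (u, v) \<in> tree_edges T \<and> (\<forall>y \<in> set v. good_letter y)"
    if u: "u \<in> tree_verts T" "\<forall>y \<in> set u. good_letter y" "\<not> leaf T u" for u
  proof -
    have "EC_rule discs T u" using EC u by (simp add: EC_def)
    then consider x where "children T u = {u @ [x]}"
        "line_step u x \<or> (\<exists>b c. compass_step b c u x) \<or> intersection_step u x \<or> x \<in> Fig ` discs"
      | S where "S \<in> discs" "children T u = {u @ [Pt p] | p. p \<in> S}"
      using u(3) unfolding EC_rule_def by blast
    then show ?thesis
    proof cases
      case 1
      then have e: "(u, u @ [x]) \<in> tree_edges T" by (auto simp: children_def)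
      have "good_letter x"
        using 1(2)
      proof (elim disjE exE)
        \<comment> \<open>This \<open>c\<close> is an endpoint of the radius and shadows the center
          of the circle.\<close>
        fix b c assume b: "compass_step b c u x"
        with e se have "b = c" by (auto simp: straightedge_def)
        with b u(2) copy_good show ?thesis by blast
      qed (use u(2) line_step_good intersection_step_good in auto)
      with e u(2) show ?thesis by (intro exI[of _ "u @ [x]"]) auto
    next
      case 2
      \<comment> \<open>The only free choice on the branch: density supplies a good point in the
        disc.\<close>
      then obtain p where "p \<in> S" "p \<in> good_points"
        using good_points_dense unfolding discs_def by blast
      with 2 u(2) show ?thesis
        by (intro exI[of _ "u @ [Pt p]"]) (auto simp: children_def)
    qed
  qed
  moreover have "\<forall>y \<in> set (tree_root T). good_letter y" by (simp add: root)
  ultimately obtain B where B: "branch T B" "\<And>u. u \<in> walk_verts B \<Longrightarrow> \<forall>y \<in> set u. good_letter y"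
    using rooted_tree_branch_invariant[OF T, where P = "\<lambda>u. \<forall>y \<in> set u. good_letter y"] by blast
  then show ?thesis
    using center_not_good that by (metis good_letter.simps(1))
qed

end

theorem theorem2p10:
  fixes k :: "point set" and c :: point and \<rho> :: real
  assumes "\<rho> > 0" and "k = sphere c \<rho>"
  shows "(\<forall>T. classical_EC T \<and> straightedge T \<and> tree_root T = [Fig k] \<longrightarrow>
            (\<exists>B. branch T B \<and> (\<forall>u \<in> walk_verts B. Pt c \<notin> set u)))
         \<and> \<not> constructs discs straightedge {[Pt c]} [Fig k]"
proof -
  \<comment> \<open>A countable field cannot exhaust the interval, which yields the
    velocity.\<close>
  have "uncountable {0<..<1::real}" by (simp add: uncountable_open_interval)
  then obtain s where s: "s \<in> {0<..<1}" "s \<notin> constructible"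
    using countable_constructible by (meson countable_subset subsetI)
  then interpret boosted_circle c \<rho> s
    using assms by unfold_locales auto
  have *: "\<exists>B. branch T B \<and> (\<forall>u \<in> walk_verts B. Pt c \<notin> set u)"
    if "classical_EC T" "straightedge T" "tree_root T = [Fig k]" for T
    using good_branch[of T] that assms by metis
  moreover have "\<not> constructs discs straightedge {[Pt c]} [Fig k]"
  proof
    assume "constructs discs straightedge {[Pt c]} [Fig k]"
    then obtain T where T: "classical_EC T" "straightedge T" "terminating T"
        "tree_root T = [Fig k]"
      and leaves: "\<And>u. leaf T u \<Longrightarrow> \<exists>j < length u. drop j u = [Pt c]"
      by (auto simp: constructs_def)
    obtain B where B: "branch T B" "\<forall>u \<in> walk_verts B. Pt c \<notin> set u"
      using *[OF T(1,2,4)] by blast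
    \<comment> \<open>Termination makes the branch finite, so it ends in a leaf. The word there
      avoids the center, yet would have to end with it.\<close>
    then obtain us where us: "B = Fin_Walk us" using T(3) by (auto simp: terminating_def)
    have "rooted_tree T" using T(1) by (simp add: EC_def)
    then have "is_walk T (Fin_Walk us)" "leaf T (last us)"
      using B(1) us branch_iff(1) by blast+
    then have "Pt c \<notin> set (last us)" "\<exists>j. drop j (last us) = [Pt c]"
      using B(2) us leaves by (simp, blast)
    then show False by (metis in_set_dropD list.set_intros(1))
  qed
  ultimately show ?thesis by blast
qed

end
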